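(* Let $\mathcal{T}=(G,A,B)$ be a nondegenerate triple factorisation of a finite group $G$ with $\mathrm{core}_G(A)=1$. Then there exist subgroups $H,K$ such that $A\leq K<H\leq G$, $K$ is maximal in $H$, $G=HB$, and the quotient of $(H,K,BN\cap H)$ modulo $\mathrm{core}_H(K)$ is a primitive triple factorisation, where $N=\mathrm{core}_G(K)$. In particular, if $A$ is maximal in $G$ (so that $K=A$ and $H=G$), then $\mathcal{T}$ is primitive.
   Context: A triple factorisation $(G,A,B)$ consists of a finite group $G$ and subgroups $A,B\le G$ with $G=ABA$; it is nondegenerate if $G\neq AB$. $\mathrm{core}_G(H)=\bigcap_{g\in G}H^g$, and $H$ is core-free in $G$ if $\mathrm{core}_G(H)=1$. The quotient of a triple $(G,A,B)$ modulo a normal subgroup $M$ of $G$ is $(G/M,AM/M,BM/M)$. A triple factorisation $(G,A,B)$ is primitive if it is nondegenerate, $A$ is a maximal subgroup of $G$, and both $A$ and $B$ are core-free in $G$. *)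

theory Defs
  imports "HOL-Algebra.Coset"
begin

definition maximal_subgroup :: "'a set \<Rightarrow> ('a, 'b) monoid_scheme \<Rightarrow> bool" where
  "maximal_subgroup M G \<longleftrightarrow>
     subgroup M G \<and> M \<noteq> carrier G \<and>
     (\<forall>J. subgroup J G \<and> M \<subseteq> J \<longrightarrow> J = M \<or> J = carrier G)"

text \<open>The intersection of the conjugates \<open>H\<^sup>g = g\<^sup>-\<^sup>1 H g\<close> with \<open>g\<close> in the carrier.
  The core of \<open>K\<close> in a subgroup \<open>H\<close> of \<open>G\<close> is \<open>core_in (G\<lparr>carrier := H\<rparr>) K\<close>.\<close>

definition core_in :: "('a, 'b) monoid_scheme \<Rightarrow> 'a set \<Rightarrow> 'a set" where
  "core_in G H = (\<Inter>g\<in>carrier G. inv\<^bsub>G\<^esub> g <#\<^bsub>G\<^esub> (H #>\<^bsub>G\<^esub> g))"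

definition core_free :: "('a, 'b) monoid_scheme \<Rightarrow> 'a set \<Rightarrow> bool" where
  "core_free G H \<longleftrightarrow> core_in G H = {\<one>\<^bsub>G\<^esub>}"

fun triple_factorisation :: "('a, 'b) monoid_scheme \<times> 'a set \<times> 'a set \<Rightarrow> bool" where
  "triple_factorisation (G, A, B) \<longleftrightarrow>
     group G \<and> finite (carrier G) \<and> subgroup A G \<and> subgroup B G \<and>
     carrier G = A <#>\<^bsub>G\<^esub> B <#>\<^bsub>G\<^esub> A"

fun nondegenerate_triple_factorisation ::
    "('a, 'b) monoid_scheme \<times> 'a set \<times> 'a set \<Rightarrow> bool" where
  "nondegenerate_triple_factorisation (G, A, B) \<longleftrightarrow>
     triple_factorisation (G, A, B) \<and> carrier G \<noteq> A <#>\<^bsub>G\<^esub> B"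

fun primitive_triple_factorisation ::
    "('a, 'b) monoid_scheme \<times> 'a set \<times> 'a set \<Rightarrow> bool" where
  "primitive_triple_factorisation (G, A, B) \<longleftrightarrow>
     nondegenerate_triple_factorisation (G, A, B) \<and>
     maximal_subgroup A G \<and> core_free G A \<and> core_free G B"

text \<open>The quotient \<open>(G/M, AM/M, BM/M)\<close>, for \<open>M\<close> normal in \<open>G\<close>: the subgroup \<open>AM/M\<close> of \<open>G/M\<close>
  is the set of cosets of \<open>M\<close> in \<open>AM\<close>.\<close>

fun quotient_triple ::
    "('a, 'b) monoid_scheme \<times> 'a set \<times> 'a set \<Rightarrow> 'a set \<Rightarrow>
     'a set monoid \<times> 'a set set \<times> 'a set set" where
  "quotient_triple (G, A, B) M =
     (G Mod M,
      rcosets\<^bsub>G\<lparr>carrier := A <#>\<^bsub>G\<^esub> M\<rparr>\<^esub> M,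
      rcosets\<^bsub>G\<lparr>carrier := B <#>\<^bsub>G\<^esub> M\<rparr>\<^esub> M)"

end

theory Submission
  imports Defs "HOL-Algebra.Zassenhaus"
begin

text \<open>
  Write \<open>A \<le> K < H \<le> G\<close> for the subgroups to be found. Take \<open>H\<close> minimal among the subgroups
  that contain \<open>A\<close> and satisfy \<open>G = HB\<close>; the group \<open>G\<close> itself is a candidate. As \<open>G \<noteq> AB\<close>,
  \<open>H\<close> properly contains \<open>A\<close>, so \<open>A\<close> lies in some maximal subgroup \<open>K\<close> of \<open>H\<close>, and minimality of
  \<open>H\<close> gives \<open>G \<noteq> KB\<close>.

  The triple \<open>(H, K, BN \<inter> H)\<close> with \<open>N = core\<^sub>G(K)\<close> is a nondegenerate factorisation. If \<open>h = aba'\<close>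
  lies in \<open>H\<close> with \<open>a, a' \<in> A\<close>, then \<open>b\<close> lies in \<open>B \<inter> H\<close>, so \<open>H = K(B \<inter> H)K\<close>. If \<open>H\<close> were
  \<open>K(BN \<inter> H)\<close>, it would be contained in \<open>KBN = KNB = KB\<close>, and \<open>G = HB\<close> would be contained in \<open>KB\<close>.

  It remains to divide by \<open>core\<^sub>H(K)\<close>, the kernel of a projection. Factorisations, nondegeneracy and
  maximality pass to the image of an epimorphism whose kernel lies in the first factor, and the image
  of \<open>K\<close> becomes core-free when the kernel is the core of \<open>K\<close>. Core-freeness of the second factor
  then comes for free (\<open>normal_subgroup_of_second_factor\<close>): a normal subgroup \<open>M\<close> inside the second
  factor \<open>B\<close> lies in the maximal subgroup \<open>A\<close>, since otherwise \<open>G = AM \<subseteq> AB\<close>; being normal, it then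
  lies in the core of \<open>A\<close>. The same argument, applied to \<open>(G, A, B)\<close>, gives the final claim.
\<close>

section \<open>Cores of subgroups\<close>

context group
begin

lemma core_in_iff:
  assumes "K \<subseteq> carrier G"
  shows "x \<in> core_in G K \<longleftrightarrow> x \<in> carrier G \<and> (\<forall>g\<in>carrier G. g \<otimes> x \<otimes> inv g \<in> K)"
proof -
  have conj: "x \<in> inv g <# (K #> g) \<longleftrightarrow> x \<in> carrier G \<and> g \<otimes> x \<otimes> inv g \<in> K"
    if g: "g \<in> carrier G" for g
  proof
    assume "x \<in> inv g <# (K #> g)"
    then obtain k where k: "k \<in> K" "x = inv g \<otimes> (k \<otimes> g)"
      by (auto simp: l_coset_def r_coset_def)
    with assms g have "g \<otimes> x \<otimes> inv g = k"
      by (metis inv_closed inv_solve_left inv_solve_right' m_closed subsetD)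
    with k g assms show "x \<in> carrier G \<and> g \<otimes> x \<otimes> inv g \<in> K" by auto
  next
    assume x: "x \<in> carrier G \<and> g \<otimes> x \<otimes> inv g \<in> K"
    with g have "x = inv g \<otimes> (g \<otimes> x \<otimes> inv g \<otimes> g)"
      by (metis inv_closed inv_solve_left inv_solve_right' m_closed)
    with x show "x \<in> inv g <# (K #> g)"
      unfolding l_coset_def r_coset_def by blast
  qed
  show ?thesis
    unfolding core_in_def using conj one_closed by blast
qed

lemma core_in_subset:
  assumes "K \<subseteq> carrier G"
  shows "core_in G K \<subseteq> K"
proof
  fix x assume "x \<in> core_in G K"
  then have "x \<in> carrier G" "\<one> \<otimes> x \<otimes> inv \<one> \<in> K"
    using core_in_iff[OF assms] one_closed by blast+
  then show "x \<in> K" by simp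
qed

lemma normal_core_in:
  assumes K: "subgroup K G"
  shows "core_in G K \<lhd> G"
proof (rule normal_invI)
  note K_sub = subgroup.subset[OF K]
  show "subgroup (core_in G K) G"
  proof (rule subgroupI)
    show "core_in G K \<subseteq> carrier G" using core_in_iff[OF K_sub] by blast
    have "\<one> \<in> core_in G K" using subgroup.one_closed[OF K] by (simp add: core_in_iff[OF K_sub])
    then show "core_in G K \<noteq> {}" by blast
    show "inv x \<in> core_in G K" if "x \<in> core_in G K" for x
    proof -
      have x: "x \<in> carrier G" "\<And>g. g \<in> carrier G \<Longrightarrow> g \<otimes> x \<otimes> inv g \<in> K"
        using that core_in_iff[OF K_sub] by blast+
      have "g \<otimes> inv x \<otimes> inv g \<in> K" if g: "g \<in> carrier G" for g
      proof -
        have "g \<otimes> inv x \<otimes> inv g = inv (g \<otimes> x \<otimes> inv g)"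
          using g x(1) by (simp add: inv_mult_group m_assoc)
        then show ?thesis using subgroup.m_inv_closed[OF K x(2)[OF g]] by simp
      qed
      with x(1) show ?thesis by (simp add: core_in_iff[OF K_sub])
    qed
    show "x \<otimes> y \<in> core_in G K" if "x \<in> core_in G K" "y \<in> core_in G K" for x y
    proof -
      have x: "x \<in> carrier G" "\<And>g. g \<in> carrier G \<Longrightarrow> g \<otimes> x \<otimes> inv g \<in> K"
        and y: "y \<in> carrier G" "\<And>g. g \<in> carrier G \<Longrightarrow> g \<otimes> y \<otimes> inv g \<in> K"
        using that core_in_iff[OF K_sub] by blast+
      have "g \<otimes> (x \<otimes> y) \<otimes> inv g \<in> K" if g: "g \<in> carrier G" for g
      proof -
        have "inv g \<otimes> (g \<otimes> (y \<otimes> inv g)) = y \<otimes> inv g"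
          using g y(1) by (simp add: m_assoc[symmetric])
        then have "g \<otimes> (x \<otimes> y) \<otimes> inv g = (g \<otimes> x \<otimes> inv g) \<otimes> (g \<otimes> y \<otimes> inv g)"
          using g x(1) y(1) by (simp add: m_assoc)
        then show ?thesis using subgroup.m_closed[OF K x(2)[OF g] y(2)[OF g]] by simp
      qed
      with x(1) y(1) show ?thesis by (simp add: core_in_iff[OF K_sub])
    qed
  qed
  show "h \<otimes> x \<otimes> inv h \<in> core_in G K" if h: "h \<in> carrier G" and "x \<in> core_in G K" for h x
  proof -
    have x: "x \<in> carrier G" "\<And>g. g \<in> carrier G \<Longrightarrow> g \<otimes> x \<otimes> inv g \<in> K"
      using that core_in_iff[OF K_sub] by blast+
    have "g \<otimes> (h \<otimes> x \<otimes> inv h) \<otimes> inv g \<in> K" if g: "g \<in> carrier G" for g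
    proof -
      have "g \<otimes> (h \<otimes> x \<otimes> inv h) \<otimes> inv g = (g \<otimes> h) \<otimes> x \<otimes> inv (g \<otimes> h)"
        using g h x(1) by (simp add: inv_mult_group m_assoc)
      then show ?thesis using x(2)[of "g \<otimes> h"] g h by simp
    qed
    with x(1) h show ?thesis by (simp add: core_in_iff[OF K_sub])
  qed
qed

lemma normal_subset_core_in:
  assumes "M \<lhd> G" "M \<subseteq> K" "K \<subseteq> carrier G"
  shows "M \<subseteq> core_in G K"
proof
  fix x assume x: "x \<in> M"
  then have "x \<in> carrier G" using assms(2,3) by blast
  moreover have "g \<otimes> x \<otimes> inv g \<in> K" if "g \<in> carrier G" for g
    using normal.inv_op_closed2[OF assms(1) that x] assms(2) by blast
  ultimately show "x \<in> core_in G K" using core_in_iff[OF assms(3)] by blast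
qed

lemma subset_set_mult_left:
  assumes "X \<subseteq> carrier G" "\<one> \<in> Y"
  shows "X \<subseteq> X <#> Y"
proof
  fix x assume "x \<in> X"
  with assms have "x \<otimes> \<one> \<in> X <#> Y" "x \<in> carrier G" unfolding set_mult_def by blast+
  then show "x \<in> X <#> Y" by simp
qed

lemma subset_set_mult_right:
  assumes "Y \<subseteq> carrier G" "\<one> \<in> X"
  shows "Y \<subseteq> X <#> Y"
proof
  fix y assume "y \<in> Y"
  with assms have "\<one> \<otimes> y \<in> X <#> Y" "y \<in> carrier G" unfolding set_mult_def by blast+
  then show "y \<in> X <#> Y" by simp
qed

end

section \<open>Core-freeness of the second factor\<close>

text \<open>If \<open>M\<close> were not contained in \<open>A\<close>, then \<open>AM\<close> would be a subgroup larger than the maximal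
  subgroup \<open>A\<close>, so that \<open>G = AM \<subseteq> AB\<close>. Hence \<open>M\<close> lies in \<open>A\<close>, and by normality in its core.\<close>

lemma (in group) normal_subgroup_of_second_factor:
  assumes max: "maximal_subgroup A G" and B: "B \<subseteq> carrier G" and ne: "carrier G \<noteq> A <#> B"
    and M: "M \<lhd> G" "M \<subseteq> B"
  shows "M \<subseteq> core_in G A"
proof -
  have A: "subgroup A G" using max by (simp add: maximal_subgroup_def)
  have M': "subgroup M G" using M(1) by (rule normal_imp_subgroup)
  have "subgroup (A <#> M) G"
    using mult_norm_subgroup[OF M(1) A] commut_normal[OF A M(1)] by simp
  moreover have "A \<subseteq> A <#> M"
    using subset_set_mult_left subgroup.subset[OF A] subgroup.one_closed[OF M'] .
  ultimately have "A <#> M = A \<or> A <#> M = carrier G"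
    using max by (simp add: maximal_subgroup_def)
  moreover have "A <#> M \<noteq> carrier G"
  proof
    assume "A <#> M = carrier G"
    then have "carrier G \<subseteq> A <#> B" using mono_set_mult[OF subset_refl[of A] M(2), of G] by simp
    with ne setmult_subset_G[OF subgroup.subset[OF A] B] show False by blast
  qed
  moreover have "M \<subseteq> A <#> M"
    using subset_set_mult_right subgroup.subset[OF M'] subgroup.one_closed[OF A] .
  ultimately have "M \<subseteq> A" by simp
  with M(1) show ?thesis using normal_subset_core_in subgroup.subset[OF A] by blast
qed

lemma primitive_if_maximal_core_free:
  assumes nd: "nondegenerate_triple_factorisation (G, A, B)"
    and max: "maximal_subgroup A G" and free: "core_free G A"
  shows "primitive_triple_factorisation (G, A, B)"
proof -
  interpret group G using nd by simp
  have B: "subgroup B G" and ne: "carrier G \<noteq> A <#>\<^bsub>G\<^esub> B" using nd unfolding nondegenerate_triple_factorisation.simps triple_factorisation.simps by blast+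
  note B_sub = subgroup.subset[OF B]
  have "core_in G B \<subseteq> core_in G A"
    using normal_subgroup_of_second_factor[OF max B_sub ne normal_core_in[OF B] core_in_subset[OF B_sub]] .
  moreover have "\<one>\<^bsub>G\<^esub> \<in> core_in G B"
    using subgroup.one_closed[OF normal_imp_subgroup[OF normal_core_in[OF B]]] .
  ultimately have "core_free G B" using free by (auto simp: core_free_def)
  with nd max free show ?thesis by (simp only: primitive_triple_factorisation.simps)
qed

section \<open>Images under epimorphisms\<close>

text \<open>The kernel condition means that \<open>A\<close> is the full preimage of its image. Maximality, core-freeness
  and nondegeneracy of the image are therefore questions about membership in \<open>A\<close> itself.\<close>

lemma (in group_hom) image_mem_iff:
  assumes A: "subgroup A G" and ker: "kernel G H h \<subseteq> A" and x: "x \<in> carrier G"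
  shows "h x \<in> h ` A \<longleftrightarrow> x \<in> A"
proof
  assume "h x \<in> h ` A"
  then obtain a where a: "a \<in> A" "h x = h a" by blast
  then have aG: "a \<in> carrier G" using subgroup.mem_carrier[OF A] by blast
  with x a have "x \<otimes> inv a \<in> kernel G H h" by (simp add: kernel_def)
  with ker have "x \<otimes> inv a \<in> A" by blast
  then have "x \<otimes> inv a \<otimes> a \<in> A" using a(1) subgroup.m_closed[OF A] by blast
  with x aG show "x \<in> A" by (simp add: G.m_assoc)
qed blast

lemma (in group_hom) maximal_subgroup_image:
  assumes surj: "h ` carrier G = carrier H" and max: "maximal_subgroup A G"
    and ker: "kernel G H h \<subseteq> A"
  shows "maximal_subgroup (h ` A) H"
  unfolding maximal_subgroup_def
proof (intro conjI allI impI)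
  have A: "subgroup A G" and A_ne: "A \<noteq> carrier G"
    using max by (auto simp: maximal_subgroup_def)
  show "subgroup (h ` A) H" using subgroup_img_is_subgroup[OF A] .
  show "h ` A \<noteq> carrier H"
    using A_ne image_mem_iff[OF A ker] subgroup.subset[OF A] surj by blast
  fix J assume J: "subgroup J H \<and> h ` A \<subseteq> J"
  define P where "P = {x \<in> carrier G. h x \<in> J}"
  have "subgroup P G"
  proof (rule G.subgroupI)
    show "P \<noteq> {}" unfolding P_def using J subgroup.one_closed[of J H] hom_one by force
  qed (use J in \<open>auto simp: P_def subgroup.m_closed subgroup.m_inv_closed\<close>)
  moreover have "A \<subseteq> P" using J subgroup.subset[OF A] by (auto simp: P_def)
  ultimately have "P = A \<or> P = carrier G" using max by (simp add: maximal_subgroup_def)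
  moreover have "h ` P = J"
  proof -
    have "J \<subseteq> h ` carrier G" using J subgroup.subset[of J H] surj by simp
    then show ?thesis by (auto simp: P_def)
  qed
  ultimately show "J = h ` A \<or> J = carrier H" using surj by auto
qed

lemma (in group_hom) nondegenerate_image:
  assumes surj: "h ` carrier G = carrier H"
    and nd: "nondegenerate_triple_factorisation (G, A, B)" and ker: "kernel G H h \<subseteq> A"
  shows "nondegenerate_triple_factorisation (H, h ` A, h ` B)"
proof -
  have fin: "finite (carrier G)" and A: "subgroup A G" and B: "subgroup B G"
    and ABA: "carrier G = A <#> B <#> A" and ne: "carrier G \<noteq> A <#> B"
    using nd unfolding nondegenerate_triple_factorisation.simps triple_factorisation.simps by blast+
  note A_sub = subgroup.subset[OF A] and B_sub = subgroup.subset[OF B]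
  have AB_sub: "A <#> B \<subseteq> carrier G" using G.setmult_subset_G[OF A_sub B_sub] .
  have AB: "h ` (A <#> B) = h ` A <#>\<^bsub>H\<^esub> h ` B"
    using set_mult_hom[OF homh A_sub B_sub] .
  have "carrier H = h ` A <#>\<^bsub>H\<^esub> h ` B <#>\<^bsub>H\<^esub> h ` A"
    using set_mult_hom[OF homh AB_sub A_sub] surj ABA AB by simp
  moreover have "carrier H \<noteq> h ` A <#>\<^bsub>H\<^esub> h ` B"
  proof
    assume eq: "carrier H = h ` A <#>\<^bsub>H\<^esub> h ` B"
    have "x \<in> A <#> B" if x: "x \<in> carrier G" for x
    proof -
      have "h x \<in> h ` (A <#> B)" using AB eq x by auto
      then obtain a b where ab: "a \<in> A" "b \<in> B" "h x = h (a \<otimes> b)"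
        by (auto simp: set_mult_def)
      then have abG: "a \<in> carrier G" "b \<in> carrier G" using A_sub B_sub by auto
      \<comment> \<open>A correction by an element of the kernel is absorbed by \<open>A\<close>, the left factor.\<close>
      have "h (x \<otimes> inv b) = h a"
        using x abG ab(3) by (simp add: H.m_assoc)
      then have "x \<otimes> inv b \<in> A"
        using image_mem_iff[OF A ker, of "x \<otimes> inv b"] x abG ab(1) by simp
      moreover have "x = x \<otimes> inv b \<otimes> b" using x abG by (simp add: G.m_assoc)
      ultimately show ?thesis using ab(2) unfolding set_mult_def by blast
    qed
    with AB_sub ne show False by blast
  qed
  moreover have "finite (carrier H)" using fin surj by (metis finite_imageI)
  ultimately show ?thesis
    using subgroup_img_is_subgroup[OF A] subgroup_img_is_subgroup[OF B] H.is_group by simp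
qed

lemma (in group_hom) core_free_image:
  assumes surj: "h ` carrier G = carrier H" and A: "subgroup A G"
    and ker: "kernel G H h = core_in G A"
  shows "core_free H (h ` A)"
proof -
  note A_sub = subgroup.subset[OF A]
  have ker_sub: "kernel G H h \<subseteq> A" using ker G.core_in_subset[OF A_sub] by simp
  have hA: "subgroup (h ` A) H" using subgroup_img_is_subgroup[OF A] .
  have "y = \<one>\<^bsub>H\<^esub>" if y: "y \<in> core_in H (h ` A)" for y
  proof -
    have yH: "y \<in> carrier H" and
      conj: "\<And>g. g \<in> carrier H \<Longrightarrow> g \<otimes>\<^bsub>H\<^esub> y \<otimes>\<^bsub>H\<^esub> inv\<^bsub>H\<^esub> g \<in> h ` A"
      using y H.core_in_iff[OF subgroup.subset[OF hA]] by blast+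
    obtain x where x: "x \<in> carrier G" "y = h x" using yH surj by blast
    have "g \<otimes> x \<otimes> inv g \<in> A" if g: "g \<in> carrier G" for g
    proof -
      have "h (g \<otimes> x \<otimes> inv g) \<in> h ` A" using conj[of "h g"] g x by simp
      then show ?thesis using image_mem_iff[OF A ker_sub, of "g \<otimes> x \<otimes> inv g"] g x(1) by simp
    qed
    with x(1) have "x \<in> kernel G H h" unfolding ker G.core_in_iff[OF A_sub] by blast
    then show ?thesis using x by (simp add: kernel_def)
  qed
  moreover have "\<one>\<^bsub>H\<^esub> \<in> core_in H (h ` A)"
    using subgroup.one_closed[OF normal_imp_subgroup[OF H.normal_core_in[OF hA]]] .
  ultimately show ?thesis unfolding core_free_def by blast
qed

section \<open>The quotient by the core\<close>

text \<open>The cosets of \<open>M\<close> in \<open>AM\<close> are those that meet \<open>A\<close>, so the quotient is the image of the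
  triple under the projection, and the results on epimorphisms apply to it.\<close>

lemma (in group) quotient_triple_eq_image:
  assumes M: "M \<lhd> G" and A: "A \<subseteq> carrier G" and B: "B \<subseteq> carrier G"
  shows "quotient_triple (G, A, B) M = (G Mod M, (\<lambda>x. M #> x) ` A, (\<lambda>x. M #> x) ` B)"
proof -
  interpret normal M G by (rule M)
  have image: "rcosets\<^bsub>G\<lparr>carrier := X <#> M\<rparr>\<^esub> M = (\<lambda>x. M #> x) ` X"
    if X: "X \<subseteq> carrier G" for X
  proof -
    have "M #> (x \<otimes> m) = M #> x" if "x \<in> X" "m \<in> M" for x m
    proof -
      have xm: "x \<in> carrier G" "m \<in> carrier G" using that X by auto
      have "x \<otimes> m = (x \<otimes> m \<otimes> inv x) \<otimes> x" using xm by (simp add: m_assoc)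
      then have "x \<otimes> m \<in> M #> x"
        using inv_op_closed2[OF xm(1) that(2)] unfolding r_coset_def by blast
      then show ?thesis using repr_independence[OF _ xm(1) is_subgroup] by simp
    qed
    moreover have "X \<subseteq> X <#> M" using subset_set_mult_left[OF X one_closed] .
    ultimately show ?thesis
      unfolding RCOSETS_def by (fastforce simp: set_mult_def)
  qed
  show ?thesis using image[OF A] image[OF B] by simp
qed

lemma primitive_quotient_by_core:
  assumes nd: "nondegenerate_triple_factorisation (G, A, B)" and max: "maximal_subgroup A G"
  shows "primitive_triple_factorisation (quotient_triple (G, A, B) (core_in G A))"
proof -
  interpret group G using nd by simp
  have A: "subgroup A G" and B: "subgroup B G" using nd unfolding nondegenerate_triple_factorisation.simps triple_factorisation.simps by blast+
  let ?M = "core_in G A"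
  have M: "?M \<lhd> G" using normal_core_in[OF A] .
  then interpret M: normal ?M G .
  let ?h = "\<lambda>x. ?M #>\<^bsub>G\<^esub> x"
  interpret hom: group_hom G "G Mod ?M" ?h
    by (intro group_hom.intro group_hom_axioms.intro is_group M.factorgroup_is_group
        M.r_coset_hom_Mod)
  have surj: "?h ` carrier G = carrier (G Mod ?M)" by (simp add: carrier_FactGroup)
  have ker: "kernel G (G Mod ?M) ?h = ?M"
  proof -
    have "?h x = ?M \<longleftrightarrow> x \<in> ?M" if "x \<in> carrier G" for x
      using coset_join1[OF _ that M.is_subgroup] coset_join2[OF that M.is_subgroup] by blast
    then show ?thesis using M.subset unfolding kernel_def by auto
  qed
  have ker_sub: "kernel G (G Mod ?M) ?h \<subseteq> A"
    using ker core_in_subset[OF subgroup.subset[OF A]] by simp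
  show ?thesis
    unfolding quotient_triple_eq_image[OF M subgroup.subset[OF A] subgroup.subset[OF B]]
    using primitive_if_maximal_core_free hom.nondegenerate_image[OF surj nd ker_sub]
      hom.maximal_subgroup_image[OF surj max ker_sub] hom.core_free_image[OF surj A ker] .
qed

section \<open>Choice of the two subgroups\<close>

lemma (in group) maximal_subgroup_above:
  assumes fin: "finite (carrier G)" and A: "subgroup A G" "A \<noteq> carrier G"
  obtains K where "maximal_subgroup K G" "A \<subseteq> K"
proof -
  define S where "S = {K. subgroup K G \<and> A \<subseteq> K \<and> K \<noteq> carrier G}"
  have "S \<subseteq> Pow (carrier G)" using subgroup.subset by (auto simp: S_def)
  then have "finite S" using fin by (simp add: finite_subset)
  moreover have "S \<noteq> {}" using A by (auto simp: S_def)
  ultimately obtain K where K: "K \<in> S" "\<forall>J\<in>S. K \<subseteq> J \<longrightarrow> K = J"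
    using finite_has_maximal by metis
  then have K_sg: "subgroup K G" "A \<subseteq> K" "K \<noteq> carrier G" by (auto simp: S_def)
  have "J = K \<or> J = carrier G" if "subgroup J G" "K \<subseteq> J" for J
  proof (cases "J = carrier G")
    case False
    with that K_sg(2) have "J \<in> S" by (auto simp: S_def)
    with K(2) that(2) show ?thesis by blast
  qed simp
  with K_sg have "maximal_subgroup K G" by (simp add: maximal_subgroup_def)
  then show ?thesis using K_sg(2) by (rule that)
qed

text \<open>Since \<open>A \<le> H\<close>, Dedekind's law turns \<open>G = ABA\<close> into \<open>H = A(B \<inter> H)A\<close>. The factor \<open>N\<close> does
  not affect nondegeneracy because it can be moved next to \<open>K\<close> and is absorbed there.\<close>

lemma nondegenerate_in_subgroup:
  assumes triple: "triple_factorisation (G, A, B)"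
    and H: "subgroup H G" and K: "subgroup K G" and AK: "A \<subseteq> K" and KH: "K \<subseteq> H"
    and HB: "carrier G = H <#>\<^bsub>G\<^esub> B" and KB: "carrier G \<noteq> K <#>\<^bsub>G\<^esub> B"
    and N: "N \<lhd> G" "N \<subseteq> K"
  shows "nondegenerate_triple_factorisation
    (G\<lparr>carrier := H\<rparr>, K, (B <#>\<^bsub>G\<^esub> N) \<inter> H)"
proof -
  interpret group G using triple by simp
  have fin: "finite (carrier G)" and B: "subgroup B G"
    and ABA: "carrier G = A <#>\<^bsub>G\<^esub> B <#>\<^bsub>G\<^esub> A"
    using triple unfolding triple_factorisation.simps by blast+
  note H_sub = subgroup.subset[OF H] and K_sub = subgroup.subset[OF K]
    and B_sub = subgroup.subset[OF B]
  let ?L = "(B <#>\<^bsub>G\<^esub> N) \<inter> H"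
  have NB: "B <#>\<^bsub>G\<^esub> N = N <#>\<^bsub>G\<^esub> B" using commut_normal[OF B N(1)] .
  have BN: "subgroup (B <#>\<^bsub>G\<^esub> N) G" using mult_norm_subgroup[OF N(1) B] NB by simp
  have L: "subgroup ?L G" using subgroups_Inter_pair[OF BN H] .
  have N_sg: "subgroup N G" using N(1) by (rule normal_imp_subgroup)
  have B_BN: "B \<subseteq> B <#>\<^bsub>G\<^esub> N"
    using subset_set_mult_left[OF B_sub subgroup.one_closed[OF N_sg]] .
  have factorisation: "H = K <#>\<^bsub>G\<^esub> ?L <#>\<^bsub>G\<^esub> K"
  proof
    show "K <#>\<^bsub>G\<^esub> ?L <#>\<^bsub>G\<^esub> K \<subseteq> H"
      using KH subgroup.m_closed[OF H] unfolding set_mult_def by blast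
    show "H \<subseteq> K <#>\<^bsub>G\<^esub> ?L <#>\<^bsub>G\<^esub> K"
    proof
      fix x assume x: "x \<in> H"
      then have "x \<in> A <#>\<^bsub>G\<^esub> B <#>\<^bsub>G\<^esub> A" using H_sub ABA by blast
      then obtain a b c where abc: "a \<in> A" "b \<in> B" "c \<in> A" "x = a \<otimes>\<^bsub>G\<^esub> b \<otimes>\<^bsub>G\<^esub> c"
        by (auto simp: set_mult_def)
      then have carr: "a \<in> carrier G" "b \<in> carrier G" "c \<in> carrier G" "x \<in> carrier G"
        and aH: "a \<in> H" "c \<in> H"
        using AK KH H_sub B_sub x by blast+
      have "b = inv\<^bsub>G\<^esub> a \<otimes>\<^bsub>G\<^esub> (x \<otimes>\<^bsub>G\<^esub> inv\<^bsub>G\<^esub> c)"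
        using carr abc(4) by (metis inv_solve_left inv_solve_right inv_closed m_closed)
      then have "b \<in> H"
        using x aH by (simp add: subgroup.m_closed[OF H] subgroup.m_inv_closed[OF H])
      then have "b \<in> ?L" using abc(2) B_BN by blast
      then show "x \<in> K <#>\<^bsub>G\<^esub> ?L <#>\<^bsub>G\<^esub> K"
        using abc AK unfolding set_mult_def by blast
    qed
  qed
  have "H \<noteq> K <#>\<^bsub>G\<^esub> ?L"
  proof
    assume "H = K <#>\<^bsub>G\<^esub> ?L"
    also have "\<dots> \<subseteq> K <#>\<^bsub>G\<^esub> (N <#>\<^bsub>G\<^esub> B)" using NB by (intro mono_set_mult) auto
    also have "\<dots> = (K <#>\<^bsub>G\<^esub> N) <#>\<^bsub>G\<^esub> B"
      using set_mult_assoc[OF K_sub subgroup.subset[OF N_sg] B_sub] by simp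
    also have "\<dots> \<subseteq> K <#>\<^bsub>G\<^esub> B"
      using N(2) subgroup.m_closed[OF K] by (intro mono_set_mult) (auto simp: set_mult_def)
    finally have "H \<subseteq> K <#>\<^bsub>G\<^esub> B" .
    then have "carrier G \<subseteq> (K <#>\<^bsub>G\<^esub> B) <#>\<^bsub>G\<^esub> B"
      using HB mono_set_mult[of H "K <#>\<^bsub>G\<^esub> B" B B G] by simp
    also have "\<dots> = K <#>\<^bsub>G\<^esub> B"
      using set_mult_assoc[OF K_sub B_sub B_sub] subgroup_mult_id[OF B] by simp
    finally show False using KB setmult_subset_G[OF K_sub B_sub] by blast
  qed
  moreover have "finite H" using fin H_sub finite_subset by blast
  ultimately show ?thesis
    using factorisation subgroup_imp_group[OF H] subgroup_incl[OF K H KH]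
      subgroup_incl[OF L H] by simp
qed

theorem corollary1p3:
  fixes G :: "('a, 'b) monoid_scheme" and A B :: "'a set"
  assumes "nondegenerate_triple_factorisation (G, A, B)"
    and "core_in G A = {\<one>\<^bsub>G\<^esub>}"
  shows "(\<exists>H K. subgroup H G \<and> subgroup K G \<and> A \<subseteq> K \<and> K \<subset> H \<and>
           maximal_subgroup K (G\<lparr>carrier := H\<rparr>) \<and>
           carrier G = H <#>\<^bsub>G\<^esub> B \<and>
           primitive_triple_factorisation
             (quotient_triple
               (G\<lparr>carrier := H\<rparr>, K, (B <#>\<^bsub>G\<^esub> core_in G K) \<inter> H)
               (core_in (G\<lparr>carrier := H\<rparr>) K))) \<and>
         (maximal_subgroup A G \<longrightarrow>
           (\<forall>H K. subgroup H G \<and> subgroup K G \<and> A \<subseteq> K \<and> K \<subset> H \<longrightarrow>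
                  K = A \<and> H = carrier G) \<and>
           primitive_triple_factorisation (G, A, B))"
proof -
  have nd: "nondegenerate_triple_factorisation (G, A, B)" by fact
  then interpret group G by simp
  have fin: "finite (carrier G)" and A: "subgroup A G" and B: "subgroup B G"
    and ne: "carrier G \<noteq> A <#>\<^bsub>G\<^esub> B" and triple: "triple_factorisation (G, A, B)"
    using nd unfolding nondegenerate_triple_factorisation.simps triple_factorisation.simps by blast+
  let ?S = "{H. subgroup H G \<and> A \<subseteq> H \<and> carrier G = H <#>\<^bsub>G\<^esub> B}"
  have "?S \<subseteq> Pow (carrier G)" using subgroup.subset by blast
  then have "finite ?S" using fin by (simp add: finite_subset)
  moreover have "carrier G \<in> ?S"
    using subgroup_self subgroup.subset[OF A] set_mult_carrier_idem[OF B] by simp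
  ultimately obtain H where "H \<in> ?S" and min: "\<forall>J\<in>?S. J \<subseteq> H \<longrightarrow> H = J"
    using finite_has_minimal[of ?S] by blast
  then have H: "subgroup H G" "A \<subseteq> H" "carrier G = H <#>\<^bsub>G\<^esub> B" by auto
  have "A \<noteq> H" using ne H(3) by blast
  moreover have "finite H" using fin subgroup.subset[OF H(1)] finite_subset by blast
  ultimately obtain K where max: "maximal_subgroup K (G\<lparr>carrier := H\<rparr>)" and AK: "A \<subseteq> K"
    using group.maximal_subgroup_above[OF subgroup_imp_group[OF H(1)] _ subgroup_incl[OF A H(1,2)]]
    by auto
  have K_in_H: "subgroup K (G\<lparr>carrier := H\<rparr>)" and "K \<noteq> H"
    using max by (auto simp: maximal_subgroup_def)
  then have KH: "K \<subset> H" using subgroup.subset[OF K_in_H] by auto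
  have K: "subgroup K G" using incl_subgroup[OF H(1) K_in_H] .
  have "K \<notin> ?S" using min KH by blast
  with K AK have KB: "carrier G \<noteq> K <#>\<^bsub>G\<^esub> B" by blast
  have "nondegenerate_triple_factorisation
      (G\<lparr>carrier := H\<rparr>, K, (B <#>\<^bsub>G\<^esub> core_in G K) \<inter> H)"
    using nondegenerate_in_subgroup[OF triple H(1) K AK _ H(3) KB normal_core_in[OF K]
        core_in_subset[OF subgroup.subset[OF K]]] KH by blast
  from primitive_quotient_by_core[OF this max]
  have reduction: "\<exists>H K. subgroup H G \<and> subgroup K G \<and> A \<subseteq> K \<and> K \<subset> H \<and>
      maximal_subgroup K (G\<lparr>carrier := H\<rparr>) \<and> carrier G = H <#>\<^bsub>G\<^esub> B \<and>
      primitive_triple_factorisation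
        (quotient_triple
          (G\<lparr>carrier := H\<rparr>, K, (B <#>\<^bsub>G\<^esub> core_in G K) \<inter> H)
          (core_in (G\<lparr>carrier := H\<rparr>) K))"
    using H K AK KH max by blast
  have unique: "K = A \<and> H = carrier G"
    if max: "maximal_subgroup A G" and HK: "subgroup H G" "subgroup K G" "A \<subseteq> K" "K \<subset> H" for H K
  proof -
    have "K = A \<or> K = carrier G" "H = A \<or> H = carrier G"
      using max HK unfolding maximal_subgroup_def by blast+
    with HK subgroup.subset[OF HK(1)] show ?thesis by blast
  qed
  have "primitive_triple_factorisation (G, A, B)" if "maximal_subgroup A G"
    using primitive_if_maximal_core_free[OF nd that] assms(2) unfolding core_free_def .
  with reduction unique show ?thesis by blast
qed

end
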